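(* Let $I\subset\mathbb{R}$ be an interval, let $a,b\in I$ with $a<b$, and let $f:I\to\mathbb{R}$ be twice differentiable on the interior $I^{\circ}$ of $I$, with $f''\in L_1[a,b]$. Let $q\ge 1$. If $|f''|^q$ is convex on $[a,b]$, then $$\left|\frac{1}{b-a}\int_a^b f(x)\,dx-f\left(\frac{a+b}{2}\right)\right|\le \frac{(b-a)^2}{24}\left[\frac{|f''(a)|^q+|f''(b)|^q}{2}\right]^{1/q}.$$
   Context: The hypotheses on $f''$ over $[a,b]$ presuppose that $f$ is twice differentiable at every point of $[a,b]$; if $a$ or $b$ is an endpoint of $I$, the derivatives $f'$ and $f''$ there are understood as one-sided derivatives. *)

theory Defs
  imports "HOL-Analysis.Analysis"
begin

end

theory Submission
  imports Defs
begin

text \<open>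
  Weighted AM--GM turns the convexity of \<open>\<bar>f''\<bar> powr q\<close> into a pointwise bound
  \<open>\<bar>f'' x\<bar> \<le> M + k * (x - c)\<close>, where \<open>c\<close> is the midpoint and \<open>M\<close> is the power mean on the
  right-hand side of the claim. Hence \<open>P \<plusminus> f\<close> is convex for the cubic \<open>P\<close> with second derivative
  \<open>M + k * (x - c)\<close>, and the midpoint form of the Hermite--Hadamard inequality for these
  two functions bounds the midpoint error of \<open>f\<close> by that of \<open>P\<close>, to which the odd term
  \<open>k * (x - c)\<close> does not contribute.
\<close>

text \<open>A convex function lies above its tangent at the midpoint, and the integral of that
  tangent is its midpoint value times the length of the interval.\<close>

lemma midpoint_le_integral:
  fixes g g' g'' :: "real \<Rightarrow> real"
  assumes "a < b" and "g integrable_on {a..b}"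
    and g': "\<And>x. x \<in> {a<..<b} \<Longrightarrow> (g has_real_derivative g' x) (at x)"
    and g'': "\<And>x. x \<in> {a<..<b} \<Longrightarrow> (g' has_real_derivative g'' x) (at x)"
    and nonneg: "\<And>x. x \<in> {a<..<b} \<Longrightarrow> g'' x \<ge> 0"
  shows "(b - a) * g ((a + b) / 2) \<le> integral {a..b} g"
proof -
  define c where "c = (a + b) / 2"
  have c: "c \<in> {a<..<b}"
    using \<open>a < b\<close> by (simp add: c_def)
  define T where "T x = g c + g' c * (x - c)" for x
  define G where "G x = g c * x + g' c * (x - c)\<^sup>2 / 2" for x
  have "(T has_integral G b - G a) {a..b}"
    unfolding T_def G_def using \<open>a < b\<close>
    by (intro fundamental_theorem_of_calculus)
      (auto intro!: derivative_eq_intros simp flip: has_real_derivative_iff_has_vector_derivative)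
  moreover have "G b - G a = (b - a) * g c"
    by (simp add: G_def c_def field_simps power2_eq_square)
  \<comment> \<open>The tangent bound is available only at interior points, so both integrals move
    to the open interval; the two endpoints do not affect them.\<close>
  ultimately have "(T has_integral (b - a) * g c) {a<..<b}"
    by (simp add: has_integral_Icc_iff_Ioo)
  moreover have "(g has_integral integral {a..b} g) {a<..<b}"
    using integrable_integral[OF assms(2)] by (simp add: has_integral_Icc_iff_Ioo)
  moreover have "T x \<le> g x" if "x \<in> {a<..<b}" for x
    using f''_imp_f'[OF _ g' g'' nonneg c that] by (simp add: T_def)
  ultimately show ?thesis
    unfolding c_def by (rule has_integral_le)
qed

lemma midpoint_error_le:
  fixes f f' f'' :: "real \<Rightarrow> real"
  assumes "a < b" and int: "f integrable_on {a..b}"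
    and f': "\<And>x. x \<in> {a<..<b} \<Longrightarrow> (f has_real_derivative f' x) (at x)"
    and f'': "\<And>x. x \<in> {a<..<b} \<Longrightarrow> (f' has_real_derivative f'' x) (at x)"
    and bound: "\<And>x. x \<in> {a<..<b} \<Longrightarrow> \<bar>f'' x\<bar> \<le> M + k * (x - (a + b) / 2)"
  shows "\<bar>integral {a..b} f - (b - a) * f ((a + b) / 2)\<bar> \<le> M * (b - a) ^ 3 / 24"
proof -
  define c where "c = (a + b) / 2"
  \<comment> \<open>Integrating from \<open>c\<close> makes \<open>P c = 0\<close>, so the midpoint
    error of \<open>P\<close> is just its integral.\<close>
  define P where "P x = M * (x - c)\<^sup>2 / 2 + k * (x - c) ^ 3 / 6" for x
  define P' where "P' x = M * (x - c) + k * (x - c)\<^sup>2 / 2" for x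
  define Q where "Q x = M * (x - c) ^ 3 / 6 + k * (x - c) ^ 4 / 24" for x
  have P': "(P has_real_derivative P' x) (at x)" for x
    unfolding P_def P'_def by (auto intro!: derivative_eq_intros)
  have P'': "(P' has_real_derivative M + k * (x - c)) (at x)" for x
    unfolding P'_def by (auto intro!: derivative_eq_intros)
  have Q': "(Q has_real_derivative P x) (at x within {a..b})" for x
    unfolding Q_def P_def by (auto intro!: derivative_eq_intros)
  have "(P has_integral Q b - Q a) {a..b}"
    using \<open>a < b\<close> Q'
    by (intro fundamental_theorem_of_calculus)
      (auto simp flip: has_real_derivative_iff_has_vector_derivative)
  \<comment> \<open>The quartic term of \<open>Q\<close> is even about \<open>c\<close>, so
    \<open>k\<close> cancels.\<close>
  moreover have "Q b - Q a = M * (b - a) ^ 3 / 24"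
  proof -
    have half: "b - c = (b - a) / 2" "a - c = - ((b - a) / 2)"
      by (simp_all add: c_def field_simps)
    show ?thesis
      unfolding Q_def half by (simp add: power_divide)
  qed
  ultimately have P_int: "(P has_integral M * (b - a) ^ 3 / 24) {a..b}"
    by simp
  have "(b - a) * (P c + s * f c) \<le> M * (b - a) ^ 3 / 24 + s * integral {a..b} f"
    if s: "\<bar>s\<bar> = 1" for s
  proof -
    have I: "((\<lambda>x. P x + s * f x) has_integral
        M * (b - a) ^ 3 / 24 + s * integral {a..b} f) {a..b}"
      by (intro has_integral_add P_int has_integral_mult_right integrable_integral int)
    have "(b - a) * (P c + s * f c) \<le> integral {a..b} (\<lambda>x. P x + s * f x)"
      unfolding c_def
    proof (rule midpoint_le_integral[OF \<open>a < b\<close> has_integral_integrable[OF I]])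
      fix x assume x: "x \<in> {a<..<b}"
      show "((\<lambda>x. P x + s * f x) has_real_derivative P' x + s * f' x) (at x)"
        by (intro DERIV_add DERIV_cmult P' f' x)
      show "((\<lambda>x. P' x + s * f' x) has_real_derivative M + k * (x - c) + s * f'' x) (at x)"
        by (intro DERIV_add DERIV_cmult P'' f'' x)
      have "\<bar>s * f'' x\<bar> \<le> M + k * (x - c)"
        using bound[OF x] s by (simp add: abs_mult c_def)
      then show "0 \<le> M + k * (x - c) + s * f'' x"
        by linarith
    qed
    also have "\<dots> = M * (b - a) ^ 3 / 24 + s * integral {a..b} f"
      using I by (rule integral_unique)
    finally show ?thesis .
  qed
  from this[of 1] this[of "-1"]
  have "(b - a) * f c \<le> M * (b - a) ^ 3 / 24 + integral {a..b} f"
    and "- ((b - a) * f c) \<le> M * (b - a) ^ 3 / 24 - integral {a..b} f"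
    by (simp_all add: P_def)
  then show ?thesis
    unfolding c_def by linarith
qed

text \<open>Convexity puts \<open>\<bar>h x\<bar> powr q\<close> below its chord, and the concave
  function \<open>t powr (1 / q)\<close> lies below its tangent at the chord's midpoint value
  \<open>S\<close>. Composing the two affine bounds gives one with value \<open>M\<close> at the
  midpoint.\<close>

lemma powr_convex_pointwise_bound:
  fixes h :: "real \<Rightarrow> real"
  assumes "a < b" and "q \<ge> 1" and "convex_on {a..b} (\<lambda>x. \<bar>h x\<bar> powr q)"
  defines "M \<equiv> ((\<bar>h a\<bar> powr q + \<bar>h b\<bar> powr q) / 2) powr (1 / q)"
  obtains k where "\<And>x. x \<in> {a..b} \<Longrightarrow> \<bar>h x\<bar> \<le> M + k * (x - (a + b) / 2)"
proof
  define A where "A = \<bar>h a\<bar> powr q"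
  define B where "B = \<bar>h b\<bar> powr q"
  define S where "S = (A + B) / 2"
  have nonneg: "A \<ge> 0" "B \<ge> 0" "S \<ge> 0"
    by (simp_all add: A_def B_def S_def)
  have M: "M = S powr (1 / q)"
    by (simp add: M_def S_def A_def B_def)
  fix x assume x: "x \<in> {a..b}"
  define L where "L = (B - A) / (b - a) * (x - a) + A"
  have hL: "\<bar>h x\<bar> powr q \<le> L"
    using convex_onD_Icc'[OF assms(3) x] by (simp add: L_def A_def B_def)
  have L_nonneg: "L \<ge> 0"
    using hL order_trans[OF powr_ge_zero] by blast
  have LS: "L - S = (B - A) / (b - a) * (x - (a + b) / 2)"
    using \<open>a < b\<close> by (simp add: L_def S_def field_simps)
  have M_nonneg: "M \<ge> 0"
    by (simp add: M)
  have "\<bar>h x\<bar> = (\<bar>h x\<bar> powr q) powr (1 / q)"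
    using \<open>q \<ge> 1\<close> by (simp add: powr_powr)
  also have "\<dots> \<le> L powr (1 / q)"
    using hL \<open>q \<ge> 1\<close> by (intro powr_mono2) auto
  \<comment> \<open>The right-hand side is the tangent at \<open>S\<close>, since
    \<open>S powr (1 / q - 1) / q = M / (S * q)\<close> for \<open>S > 0\<close>. AM-GM is applied
    to positive numbers, so zero values are split off; for \<open>S = 0\<close> both
    \<open>M\<close> and the quotient are 0.\<close>
  also have "\<dots> \<le> M + M / (S * q) * (L - S)"
  proof (cases "L = 0 \<or> S = 0")
    case True
    have "L = 0" if "S = 0"
    proof -
      have "A = 0" "B = 0"
        using that nonneg by (auto simp: S_def)
      then show ?thesis by (simp add: L_def)
    qed
    with True have "L = 0" by blast
    moreover have "M / q \<le> M"
      using \<open>q \<ge> 1\<close> M_nonneg mult_left_mono[of 1 q M] by (simp add: divide_le_eq)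
    ultimately show ?thesis
      using M_nonneg by simp
  next
    case False
    then have "L > 0" "S > 0"
      using L_nonneg nonneg by auto
    \<comment> \<open>Dividing this by \<open>S powr (1 - 1 / q)\<close> yields the tangent
      bound.\<close>
    then have "L powr (1 / q) * S powr (1 - 1 / q) \<le> 1 / q * L + (1 - 1 / q) * S"
      using \<open>q \<ge> 1\<close> by (intro Youngs_inequality_0) auto
    moreover have "S powr (1 - 1 / q) = S / M"
      using \<open>S > 0\<close> by (simp add: M powr_diff)
    moreover have "M > 0"
      using \<open>S > 0\<close> by (simp add: M)
    ultimately have "L powr (1 / q) \<le> (1 / q * L + (1 - 1 / q) * S) * (M / S)"
      using \<open>S > 0\<close> by (simp add: pos_le_divide_eq pos_divide_le_eq)
    also have "1 / q * L + (1 - 1 / q) * S = S + (L - S) / q"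
      by (simp add: left_diff_distrib diff_divide_distrib)
    also have "(S + (L - S) / q) * (M / S) = M + M / (S * q) * (L - S)"
      using \<open>S > 0\<close> unfolding distrib_right by (simp add: mult.commute)
    finally show ?thesis .
  qed
  \<comment> \<open>This instantiates \<open>k\<close> as the tangent's slope times the chord's
    slope, which does not depend on \<open>x\<close>.\<close>
  finally show "\<bar>h x\<bar> \<le> M + M / (S * q) * ((B - A) / (b - a)) * (x - (a + b) / 2)"
    unfolding LS by (simp only: mult.assoc)
qed

theorem theorem5:
  fixes I :: "real set" and a b q :: real and f f' f'' :: "real \<Rightarrow> real"
  assumes "is_interval I" and "a \<in> I" and "b \<in> I" and "a < b"
    \<comment> \<open>At interior points of \<open>I\<close>, \<open>at x within I\<close> is \<open>at x\<close>; at an endpoint of \<open>I\<close>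
      it yields the one-sided derivative.\<close>
    and "\<And>x. x \<in> interior I \<union> {a..b} \<Longrightarrow> (f has_real_derivative f' x) (at x within I)"
    and "\<And>x. x \<in> interior I \<union> {a..b} \<Longrightarrow> (f' has_real_derivative f'' x) (at x within I)"
    and "f'' absolutely_integrable_on {a..b}"
    and "q \<ge> 1"
    and "convex_on {a..b} (\<lambda>x. \<bar>f'' x\<bar> powr q)"
  shows "\<bar>1 / (b - a) * integral {a..b} f - f ((a + b) / 2)\<bar>
    \<le> (b - a)\<^sup>2 / 24 * ((\<bar>f'' a\<bar> powr q + \<bar>f'' b\<bar> powr q) / 2) powr (1 / q)"
proof -
  define M where "M = ((\<bar>f'' a\<bar> powr q + \<bar>f'' b\<bar> powr q) / 2) powr (1 / q)"
  have sub: "{a..b} \<subseteq> I"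
    using mem_is_interval_1_I[OF assms(1-3)] by (meson atLeastAtMost_iff subsetI)
  have within: "at x within {a..b} = at x" if "x \<in> {a<..<b}" for x
    using that by (intro at_within_Icc_at) auto
  \<comment> \<open>Derivatives relative to \<open>{a..b}\<close> are one-sided at \<open>a\<close>
    and \<open>b\<close>, which still gives continuity of \<open>f\<close> on the closed interval
    and hence integrability.\<close>
  have f': "(f has_real_derivative f' x) (at x within {a..b})" if "x \<in> {a..b}" for x
    using assms(5)[OF UnI2[OF that]] sub by (rule DERIV_subset)
  have f'': "(f' has_real_derivative f'' x) (at x within {a..b})" if "x \<in> {a..b}" for x
    using assms(6)[OF UnI2[OF that]] sub by (rule DERIV_subset)
  have int: "f integrable_on {a..b}"
    by (rule integrable_continuous_real[OF DERIV_continuous_on[OF f']])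
  obtain k where "\<And>x. x \<in> {a..b} \<Longrightarrow> \<bar>f'' x\<bar> \<le> M + k * (x - (a + b) / 2)"
    using powr_convex_pointwise_bound[OF \<open>a < b\<close> \<open>q \<ge> 1\<close> assms(9)] unfolding M_def by blast
  then have bound: "\<bar>f'' x\<bar> \<le> M + k * (x - (a + b) / 2)" if "x \<in> {a<..<b}" for x
    using that by simp
  have "(f has_real_derivative f' x) (at x)" "(f' has_real_derivative f'' x) (at x)"
    if "x \<in> {a<..<b}" for x
    using f'[of x] f''[of x] within[OF that] that by auto
  then have "\<bar>integral {a..b} f - (b - a) * f ((a + b) / 2)\<bar> \<le> M * (b - a) ^ 3 / 24"
    using bound by (rule midpoint_error_le[OF \<open>a < b\<close> int])
  then have "\<bar>integral {a..b} f - (b - a) * f ((a + b) / 2)\<bar> / (b - a) \<le> M * (b - a) ^ 3 / 24 / (b - a)"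
    using \<open>a < b\<close> by (intro divide_right_mono) auto
  also have "\<dots> = (b - a)\<^sup>2 / 24 * M"
  proof -
    have "M * h ^ 3 / 24 / h = h\<^sup>2 / 24 * M" if "h \<noteq> 0" for h :: real
      using that by (simp add: power2_eq_square power3_eq_cube)
    then show ?thesis
      using \<open>a < b\<close> by (metis less_irrefl right_minus_eq)
  qed
  also have "\<bar>integral {a..b} f - (b - a) * f ((a + b) / 2)\<bar> / (b - a)
      = \<bar>(integral {a..b} f - (b - a) * f ((a + b) / 2)) / (b - a)\<bar>"
    using \<open>a < b\<close> by simp
  also have "(integral {a..b} f - (b - a) * f ((a + b) / 2)) / (b - a)
      = 1 / (b - a) * integral {a..b} f - f ((a + b) / 2)"
    using \<open>a < b\<close> by (simp add: diff_divide_distrib)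
  finally show ?thesis
    unfolding M_def .
qed

end
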